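(* Let $p$ be a prime, let $q$ and $n$ be positive integers, let $T(p,q)$ be the torus link and $R_n$ the dihedral quandle of order $n$. If $|\operatorname{Hom}(Q(T(p,q)),R_n)|=n$, then the full quandle coloring quiver of $T(p,q)$ with respect to $R_n$ is (isomorphic to) the complete directed graph $$\mathcal{Q}_{R_n}(T(p,q))=(\overleftrightarrow{K_n},\hat n).$$
   Context: A quandle is a set $X$ with a binary operation $*$ such that $(x*y)*z=(x*z)*(y*z)$ for all $x,y,z$; for each $x$ the map $R_x:X\to X$, $y\mapsto y*x$, is a bijection; and $x*x=x$ for all $x$. Write $x\bar{*}y=R_y^{-1}(x)$. The dihedral quandle $R_n$ is $\mathbb{Z}_n=\mathbb{Z}/n\mathbb{Z}$ with $x*y=2y-x \pmod n$. A quandle homomorphism is a map preserving $*$. For an oriented link $K$ with diagram $D$, the fundamental quandle $Q(K)$ is the quandle generated by the arcs of $D$ with one relation per crossing: if $y$ is the over-arc and $x,z$ are the incoming and outgoing under-arcs, then $z=x*y$ at a positive crossing and $z=x\bar{*}y$ at a negative crossing. $\operatorname{Hom}(Q(K),X)$ is the set of quandle homomorphisms $Q(K)\to X$; it is identified with the set of colorings of $D$ by $X$, i.e. maps from arcs to $X$ satisfying the crossing relations. The torus link $T(p,q)$ is the closure of the $p$-strand braid $(\sigma_1\sigma_2\cdots\sigma_{p-1})^q$. The full quandle coloring quiver $\mathcal{Q}_X(K)$ of $K$ with respect to a finite quandle $X$ is the directed multigraph with vertex set $\operatorname{Hom}(Q(K),X)$ and, for each vertex $f$ and each quandle endomorphism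 $\phi:X\to X$, one directed edge from $f$ to $\phi\circ f$. Notation: $(\overleftrightarrow{K_m},\hat\omega)$ is the directed multigraph on $m$ vertices with exactly $\omega$ directed edges from each vertex to each vertex (including from each vertex to itself). Equality of directed multigraphs means isomorphism. *)

theory Defs
  imports
    "HOL-Algebra.Congruence"
    "HOL-Library.FuncSet"
    "HOL-Computational_Algebra.Primes"
    "Graph_Theory.Digraph_Isomorphism"
begin

section \<open>Quandles\<close>

record 'a quandle = "'a partial_object" +
  qop :: "'a \<Rightarrow> 'a \<Rightarrow> 'a"

definition quandle :: "('a, 'm) quandle_scheme \<Rightarrow> bool" where
  "quandle X \<longleftrightarrow>
     (\<forall>x\<in>carrier X. \<forall>y\<in>carrier X. qop X x y \<in> carrier X) \<and>
     (\<forall>x\<in>carrier X. \<forall>y\<in>carrier X. \<forall>z\<in>carrier X.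
        qop X (qop X x y) z = qop X (qop X x z) (qop X y z)) \<and>
     (\<forall>x\<in>carrier X. bij_betw (\<lambda>y. qop X y x) (carrier X) (carrier X)) \<and>
     (\<forall>x\<in>carrier X. qop X x x = x)"

text \<open>Homomorphisms are extensional (\<^term>\<open>undefined\<close> off the carrier), so that distinct elements
  of this set are distinct as maps between the carriers and cardinalities are the intended ones.\<close>

definition quandle_hom ::
    "('a, 'm) quandle_scheme \<Rightarrow> ('b, 'k) quandle_scheme \<Rightarrow> ('a \<Rightarrow> 'b) set" where
  "quandle_hom X Y =
     {f \<in> carrier X \<rightarrow>\<^sub>E carrier Y.
        \<forall>x\<in>carrier X. \<forall>y\<in>carrier X. f (qop X x y) = qop Y (f x) (f y)}"

abbreviation quandle_end :: "('a, 'm) quandle_scheme \<Rightarrow> ('a \<Rightarrow> 'a) set" where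
  "quandle_end X \<equiv> quandle_hom X X"

text \<open>\<open>\<int>/n\<int>\<close> is represented by the residues \<open>0, \<dots>, n - 1\<close>.\<close>

definition dihedral_quandle :: "nat \<Rightarrow> int quandle" where
  "dihedral_quandle n =
     \<lparr>carrier = {0..<int n}, qop = (\<lambda>x y. (2 * y - x) mod int n)\<rparr>"

lemma quandle_dihedral:
  assumes "n > 0"
  shows "quandle (dihedral_quandle n)"
proof -
  have n: "int n > 0" using assms by simp
  have invol: "(2 * x - (2 * x - y) mod int n) mod int n = y" if "y \<in> {0..<int n}" for x y
    using that by (simp add: mod_simps)
  have "bij_betw (\<lambda>y. (2 * x - y) mod int n) {0..<int n} {0..<int n}" for x
    by (rule bij_betw_byWitness[where f' = "\<lambda>y. (2 * x - y) mod int n"])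
       (use n invol in auto)
  moreover have "(2 * z - (2 * y - x) mod int n) mod int n =
      (2 * ((2 * z - y) mod int n) - (2 * z - x) mod int n) mod int n" for x y z
  proof -
    have "(2 * ((2 * z - y) mod int n) - (2 * z - x) mod int n) mod int n =
        (2 * (2 * z - y) - (2 * z - x)) mod int n"
      by (intro mod_diff_cong mod_mult_cong) simp_all
    moreover have "(2 * z - (2 * y - x) mod int n) mod int n = (2 * z - (2 * y - x)) mod int n"
      by (simp add: mod_simps)
    ultimately show ?thesis by (simp add: algebra_simps)
  qed
  ultimately show ?thesis
    using n by (auto simp: quandle_def dihedral_quandle_def)
qed


section \<open>Oriented link diagrams and the fundamental quandle\<close>

datatype 'a crossing =
  Crossing (positive: bool) (over_arc: 'a) (under_in: 'a) (under_out: 'a)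

record 'a link_diagram =
  link_arcs :: "'a set"
  crossings :: "'a crossing set"

text \<open>The quandle presented by generators and relations is the algebra of terms in \<open>*\<close> and
  its right inverse, modulo the least congruence containing the quandle axioms (in equational form)
  and the relations.\<close>

datatype 'a qterm =
    QGen 'a
  | QOp "'a qterm" "'a qterm"
  | QInv "'a qterm" "'a qterm"

fun crossing_relation :: "'a crossing \<Rightarrow> 'a qterm \<times> 'a qterm" where
  "crossing_relation (Crossing s y x z) =
     (QGen z, if s then QOp (QGen x) (QGen y) else QInv (QGen x) (QGen y))"

abbreviation diagram_terms :: "'a link_diagram \<Rightarrow> 'a qterm set" where
  "diagram_terms D \<equiv> {t. set_qterm t \<subseteq> link_arcs D}"

inductive fq_eq :: "'a link_diagram \<Rightarrow> 'a qterm \<Rightarrow> 'a qterm \<Rightarrow> bool"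
  for D :: "'a link_diagram" where
  refl: "s \<in> diagram_terms D \<Longrightarrow> fq_eq D s s"
| sym: "fq_eq D s t \<Longrightarrow> fq_eq D t s"
| trans: "fq_eq D s t \<Longrightarrow> fq_eq D t u \<Longrightarrow> fq_eq D s u"
| cong_op: "fq_eq D s s' \<Longrightarrow> fq_eq D t t' \<Longrightarrow> fq_eq D (QOp s t) (QOp s' t')"
| cong_inv: "fq_eq D s s' \<Longrightarrow> fq_eq D t t' \<Longrightarrow> fq_eq D (QInv s t) (QInv s' t')"
| distrib: "s \<in> diagram_terms D \<Longrightarrow> t \<in> diagram_terms D \<Longrightarrow> u \<in> diagram_terms D \<Longrightarrow>
    fq_eq D (QOp (QOp s t) u) (QOp (QOp s u) (QOp t u))"
| op_inv: "s \<in> diagram_terms D \<Longrightarrow> t \<in> diagram_terms D \<Longrightarrow> fq_eq D (QInv (QOp s t) t) s"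
| inv_op: "s \<in> diagram_terms D \<Longrightarrow> t \<in> diagram_terms D \<Longrightarrow> fq_eq D (QOp (QInv s t) t) s"
| idem: "s \<in> diagram_terms D \<Longrightarrow> fq_eq D (QOp s s) s"
| crossing: "c \<in> crossings D \<Longrightarrow> set_crossing c \<subseteq> link_arcs D \<Longrightarrow>
    crossing_relation c = (s, t) \<Longrightarrow> fq_eq D s t"

definition fq_rel :: "'a link_diagram \<Rightarrow> ('a qterm \<times> 'a qterm) set" where
  "fq_rel D = {(s, t). fq_eq D s t}"

definition fundamental_quandle :: "'a link_diagram \<Rightarrow> 'a qterm set quandle" where
  "fundamental_quandle D =
     \<lparr>carrier = diagram_terms D // fq_rel D,
      qop = (\<lambda>A B. \<Union>s\<in>A. \<Union>t\<in>B. fq_rel D `` {QOp s t})\<rparr>"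

lemma fq_eq_terms: "fq_eq D s t \<Longrightarrow> s \<in> diagram_terms D \<and> t \<in> diagram_terms D"
proof (induction rule: fq_eq.induct)
  case (crossing c s t)
  then show ?case by (cases c) (auto split: if_splits)
qed auto

lemma equiv_fq_rel: "equiv (diagram_terms D) (fq_rel D)"
proof (rule equivI)
  show "fq_rel D \<subseteq> diagram_terms D \<times> diagram_terms D"
    using fq_eq_terms by (fastforce simp: fq_rel_def)
  show "refl_on (diagram_terms D) (fq_rel D)"
    by (auto simp: refl_on_def fq_rel_def intro: fq_eq.refl)
  show "sym (fq_rel D)"
    by (auto simp: sym_def fq_rel_def intro: fq_eq.sym)
  show "trans (fq_rel D)"
    by (auto simp: trans_def fq_rel_def intro: fq_eq.trans)
qed

lemma qop_fundamental_quandle: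
  assumes "s \<in> diagram_terms D" "t \<in> diagram_terms D"
  shows "qop (fundamental_quandle D) (fq_rel D `` {s}) (fq_rel D `` {t}) = fq_rel D `` {QOp s t}"
proof -
  have "congruent2 (fq_rel D) (fq_rel D) (\<lambda>s t. fq_rel D `` {QOp s t})"
    by (intro congruent2I' equiv_class_eq[OF equiv_fq_rel])
       (auto simp: fq_rel_def intro: fq_eq.cong_op)
  from UN_equiv_class2[OF equiv_fq_rel equiv_fq_rel this assms]
  show ?thesis by (simp add: fundamental_quandle_def)
qed

lemma fq_class_eqI: "fq_eq D s t \<Longrightarrow> fq_rel D `` {s} = fq_rel D `` {t}"
  by (rule equiv_class_eq[OF equiv_fq_rel]) (simp add: fq_rel_def)

lemma carrier_fundamental_quandle:
  "carrier (fundamental_quandle D) = (\<lambda>s. fq_rel D `` {s}) ` diagram_terms D"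
  by (auto simp: fundamental_quandle_def quotient_def)

lemma quandle_fundamental_quandle: "quandle (fundamental_quandle D)"
proof -
  let ?Q = "fundamental_quandle D" and ?T = "diagram_terms D"
  let ?c = "\<lambda>s. fq_rel D `` {s}"
  have op: "qop ?Q (?c s) (?c t) = ?c (QOp s t)" if "s \<in> ?T" "t \<in> ?T" for s t
    using qop_fundamental_quandle[OF that] .
  have T: "QOp s t \<in> ?T" "QInv s t \<in> ?T" if "s \<in> ?T" "t \<in> ?T" for s t
    using that by auto
  have bij: "bij_betw (\<lambda>y. qop ?Q y (?c t)) (?c ` ?T) (?c ` ?T)" if t: "t \<in> ?T" for t
    unfolding bij_betw_def
  proof
    show "inj_on (\<lambda>y. qop ?Q y (?c t)) (?c ` ?T)"
    proof (rule inj_onI)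
      fix a b assume ab: "a \<in> ?c ` ?T" "b \<in> ?c ` ?T" "qop ?Q a (?c t) = qop ?Q b (?c t)"
      then obtain r s where rs: "r \<in> ?T" "s \<in> ?T" and a: "a = ?c r" and b: "b = ?c s"
        by blast
      have "?c (QOp r t) = ?c (QOp s t)"
        using ab(3) unfolding a b op[OF rs(1) t] op[OF rs(2) t] .
      then have "fq_eq D (QOp r t) (QOp s t)"
        using eq_equiv_class_iff[OF equiv_fq_rel T(1)[OF rs(1) t] T(1)[OF rs(2) t]]
        by (simp add: fq_rel_def)
      then have "fq_eq D (QInv (QOp r t) t) (QInv (QOp s t) t)"
        using t by (intro fq_eq.cong_inv fq_eq.refl)
      then have "fq_eq D r s"
        using fq_eq.op_inv[OF rs(1) t] fq_eq.op_inv[OF rs(2) t]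
        by (elim fq_eq.trans[OF fq_eq.trans[OF fq_eq.sym]])
      then show "a = b" unfolding a b by (rule fq_class_eqI)
    qed
    show "(\<lambda>y. qop ?Q y (?c t)) ` ?c ` ?T = ?c ` ?T"
    proof
      show "(\<lambda>y. qop ?Q y (?c t)) ` ?c ` ?T \<subseteq> ?c ` ?T"
      unfolding image_image
      proof (rule image_subsetI)
        fix s assume s: "s \<in> ?T"
        show "qop ?Q (?c s) (?c t) \<in> ?c ` ?T"
          unfolding op[OF s t] using T(1)[OF s t] by (rule imageI)
      qed
      show "?c ` ?T \<subseteq> (\<lambda>y. qop ?Q y (?c t)) ` ?c ` ?T"
      proof (rule image_subsetI)
        fix s assume s: "s \<in> ?T"
        have "?c s = qop ?Q (?c (QInv s t)) (?c t)"
          using op[OF T(2)[OF s t] t] fq_class_eqI[OF fq_eq.inv_op[OF s t]] by simp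
        then show "?c s \<in> (\<lambda>y. qop ?Q y (?c t)) ` ?c ` ?T"
          using T(2)[OF s t] by blast
      qed
    qed
  qed
  have ball: "(\<forall>a\<in>?c ` ?T. P a) \<longleftrightarrow> (\<forall>s\<in>?T. P (?c s))" for P
    by blast
  show ?thesis
    unfolding quandle_def carrier_fundamental_quandle ball
  proof (intro conjI ballI)
    fix s t u assume s: "s \<in> ?T" and t: "t \<in> ?T" and u: "u \<in> ?T"
    show "qop ?Q (?c s) (?c t) \<in> ?c ` ?T"
      unfolding op[OF s t] using T(1)[OF s t] by (rule imageI)
    show "qop ?Q (qop ?Q (?c s) (?c t)) (?c u) =
        qop ?Q (qop ?Q (?c s) (?c u)) (qop ?Q (?c t) (?c u))"
      using fq_class_eqI[OF fq_eq.distrib[OF s t u]]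
      by (simp only: op T(1) s t u)
    show "bij_betw (\<lambda>y. qop ?Q y (?c s)) (?c ` ?T) (?c ` ?T)"
      by (rule bij[OF s])
    show "qop ?Q (?c s) (?c s) = ?c s"
      unfolding op[OF s s] by (rule fq_class_eqI[OF fq_eq.idem[OF s]])
  qed
qed


section \<open>Closed braids and torus links\<close>

text \<open>A letter \<open>(i, True)\<close> is \<open>\<sigma>\<^sub>i\<close>, and \<open>(i, False)\<close> is its inverse. Strands are
  numbered from left to right starting at 1 and oriented upwards. Just below the \<open>t\<close>-th letter
  (counted from 0), the strand in position \<open>j\<close> is represented by the point \<open>(j, t)\<close>. Closing the
  braid identifies the points at the top level, \<open>length w\<close>, with those at level 0. At a letter
  \<open>\<sigma>\<^sub>i\<close> the strand from \<open>i\<close> to \<open>i + 1\<close> passes over the one from \<open>i + 1\<close> to \<open>i\<close>, which is a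
  positive crossing; at its inverse the strand from \<open>i + 1\<close> to \<open>i\<close> is the over-strand.\<close>

type_synonym braid_word = "(nat \<times> bool) list"

definition braid_points :: "nat \<Rightarrow> braid_word \<Rightarrow> (nat \<times> nat) set" where
  "braid_points p w = {1..p} \<times> {0..length w}"

inductive_set braid_joins :: "nat \<Rightarrow> braid_word \<Rightarrow> ((nat \<times> nat) \<times> (nat \<times> nat)) set"
  for p :: nat and w :: braid_word where
  straight: "t < length w \<Longrightarrow> w ! t = (i, s) \<Longrightarrow> j \<in> {1..p} \<Longrightarrow> j \<noteq> i \<Longrightarrow> j \<noteq> Suc i \<Longrightarrow>
    ((j, t), (j, Suc t)) \<in> braid_joins p w"
| over_pos: "t < length w \<Longrightarrow> w ! t = (i, True) \<Longrightarrow> ((i, t), (Suc i, Suc t)) \<in> braid_joins p w"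
| over_neg: "t < length w \<Longrightarrow> w ! t = (i, False) \<Longrightarrow> ((Suc i, t), (i, Suc t)) \<in> braid_joins p w"
| closing: "j \<in> {1..p} \<Longrightarrow> ((j, length w), (j, 0)) \<in> braid_joins p w"

text \<open>An arc of the diagram is a class of points that are connected without passing under.\<close>

definition braid_arc_rel :: "nat \<Rightarrow> braid_word \<Rightarrow> ((nat \<times> nat) \<times> (nat \<times> nat)) set" where
  "braid_arc_rel p w = (braid_joins p w \<union> (braid_joins p w)\<inverse>)\<^sup>*"

abbreviation braid_arc :: "nat \<Rightarrow> braid_word \<Rightarrow> nat \<times> nat \<Rightarrow> (nat \<times> nat) set" where
  "braid_arc p w x \<equiv> braid_arc_rel p w `` {x}"

fun braid_crossing :: "nat \<Rightarrow> braid_word \<Rightarrow> nat \<Rightarrow> nat \<times> bool \<Rightarrow> (nat \<times> nat) set crossing" where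
  "braid_crossing p w t (i, True) =
     Crossing True (braid_arc p w (i, t)) (braid_arc p w (Suc i, t)) (braid_arc p w (i, Suc t))"
| "braid_crossing p w t (i, False) =
     Crossing False (braid_arc p w (Suc i, t)) (braid_arc p w (i, t)) (braid_arc p w (Suc i, Suc t))"

text \<open>This is meant for words whose letters have indices in \<open>{1..<p}\<close>.\<close>

definition braid_closure :: "nat \<Rightarrow> braid_word \<Rightarrow> (nat \<times> nat) set link_diagram" where
  "braid_closure p w =
     \<lparr>link_arcs = braid_points p w // braid_arc_rel p w,
      crossings = (\<lambda>t. braid_crossing p w t (w ! t)) ` {..<length w}\<rparr>"

definition torus_braid :: "nat \<Rightarrow> nat \<Rightarrow> braid_word" where
  "torus_braid p q = concat (replicate q (map (\<lambda>i. (i, True)) [1..<p]))"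

definition torus_link :: "nat \<Rightarrow> nat \<Rightarrow> (nat \<times> nat) set link_diagram" where
  "torus_link p q = braid_closure p (torus_braid p q)"

text \<open>All the crossing relations of a torus link diagram are between arcs of that diagram.\<close>

lemma torus_link_crossing_arcs:
  assumes "c \<in> crossings (torus_link p q)"
  shows "set_crossing c \<subseteq> link_arcs (torus_link p q)"
proof -
  let ?w = "torus_braid p q"
  obtain t where t: "t < length ?w" and c: "c = braid_crossing p ?w t (?w ! t)"
    using assms by (auto simp: torus_link_def braid_closure_def)
  have "?w ! t \<in> set ?w" using t by simp
  then obtain i where i: "?w ! t = (i, True)" "1 \<le> i" "i < p"
    unfolding torus_braid_def by (auto split: if_splits)
  have "set_crossing c \<subseteq> braid_arc p ?w ` braid_points p ?w"
    using t i by (auto simp: c braid_points_def)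
  then show ?thesis
    by (auto simp: torus_link_def braid_closure_def quotient_def)
qed


section \<open>The full quandle coloring quiver\<close>

definition full_coloring_quiver ::
    "('a, 'm) quandle_scheme \<Rightarrow> 'b link_diagram \<Rightarrow>
     ('b qterm set \<Rightarrow> 'a, ('b qterm set \<Rightarrow> 'a) \<times> ('a \<Rightarrow> 'a)) pre_digraph" where
  "full_coloring_quiver X D =
     \<lparr>verts = quandle_hom (fundamental_quandle D) X,
      arcs = quandle_hom (fundamental_quandle D) X \<times> quandle_end X,
      tail = fst,
      head = (\<lambda>(f, \<phi>). compose (carrier (fundamental_quandle D)) \<phi> f)\<rparr>"

definition complete_multidigraph :: "nat \<Rightarrow> nat \<Rightarrow> (nat, nat \<times> nat \<times> nat) pre_digraph" where
  "complete_multidigraph m \<omega> =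
     \<lparr>verts = {..<m},
      arcs = {..<m} \<times> {..<m} \<times> {..<\<omega>},
      tail = (\<lambda>(u, v, k). u),
      head = (\<lambda>(u, v, k). v)\<rparr>"

lemma compose_quandle_hom:
  assumes X: "quandle X" and f: "f \<in> quandle_hom X Y" and g: "g \<in> quandle_hom Y Z"
  shows "compose (carrier X) g f \<in> quandle_hom X Z"
proof -
  have fX: "f x \<in> carrier Y" if "x \<in> carrier X" for x
    using f that by (auto simp: quandle_hom_def)
  have gY: "g y \<in> carrier Z" if "y \<in> carrier Y" for y
    using g that by (auto simp: quandle_hom_def)
  have "compose (carrier X) g f (qop X x y) =
      qop Z (compose (carrier X) g f x) (compose (carrier X) g f y)"
    if xy: "x \<in> carrier X" "y \<in> carrier X" for x y
  proof -
    have "qop X x y \<in> carrier X" using X xy by (simp add: quandle_def)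
    moreover have "f (qop X x y) = qop Y (f x) (f y)"
      using f xy by (simp add: quandle_hom_def)
    moreover have "g (qop Y (f x) (f y)) = qop Z (g (f x)) (g (f y))"
      using g fX xy by (simp add: quandle_hom_def)
    ultimately show ?thesis using xy by (simp add: compose_eq)
  qed
  moreover have "compose (carrier X) g f \<in> carrier X \<rightarrow>\<^sub>E carrier Z"
    using fX gY by (auto simp: compose_def)
  ultimately show ?thesis unfolding quandle_hom_def by blast
qed

lemma wf_full_coloring_quiver: "wf_digraph (full_coloring_quiver X D)"
proof
  fix e assume "e \<in> arcs (full_coloring_quiver X D)"
  then obtain f \<phi> where e: "e = (f, \<phi>)"
    and f: "f \<in> quandle_hom (fundamental_quandle D) X" and \<phi>: "\<phi> \<in> quandle_end X"
    by (auto simp: full_coloring_quiver_def)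
  show "tail (full_coloring_quiver X D) e \<in> verts (full_coloring_quiver X D)"
    using f by (simp add: full_coloring_quiver_def e)
  show "head (full_coloring_quiver X D) e \<in> verts (full_coloring_quiver X D)"
    using compose_quandle_hom[OF quandle_fundamental_quandle f \<phi>]
    by (simp add: full_coloring_quiver_def e)
qed

end

(* The constant colorings by R_n are already n in number, so the hypothesis says that every coloring
   is constant; the link enters only through its diagram having an arc. The endomorphisms of R_n are
   the affine maps x \<mapsto> b + d x, because R_n is generated by 0 and 1. For fixed a and c, such a map
   sending a to c is determined by its slope d, which is arbitrary. Hence there are exactly n edges
   from the coloring with value a to the coloring with value c, labelled by d. *)

theory Submission
  imports Defs
begin

lemma carrier_dihedral [simp]: "carrier (dihedral_quandle n) = {0..<int n}"
  and qop_dihedral [simp]: "qop (dihedral_quandle n) x y = (2 * y - x) mod int n"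
  by (simp_all add: dihedral_quandle_def)

lemma quandle_hom_const:
  assumes "quandle X" "quandle Y" "y \<in> carrier Y"
  shows "(\<lambda>x\<in>carrier X. y) \<in> quandle_hom X Y"
  using assms by (auto simp: quandle_def quandle_hom_def)

text \<open>Constant maps are homomorphisms because \<open>Y\<close> is idempotent. Different values
  give different maps since \<open>carrier X\<close> is nonempty, so the constant maps alone attain
  the assumed cardinality.\<close>

lemma quandle_hom_all_const:
  assumes X: "quandle X" "carrier X \<noteq> {}" and Y: "quandle Y" "finite (carrier Y)" "carrier Y \<noteq> {}"
    and card: "card (quandle_hom X Y) = card (carrier Y)"
  shows "quandle_hom X Y = (\<lambda>y. \<lambda>x\<in>carrier X. y) ` carrier Y"
proof -
  let ?c = "\<lambda>y. \<lambda>x\<in>carrier X. y"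
  have "inj_on ?c (carrier Y)"
    using X(2) by (metis (no_types, lifting) ex_in_conv inj_onI restrict_apply')
  then have "card (?c ` carrier Y) = card (quandle_hom X Y)"
    by (simp add: card card_image)
  \<comment> \<open>\<open>card\<close> is 0 on infinite sets, so a positive cardinality forces
    finiteness.\<close>
  moreover have "finite (quandle_hom X Y)"
    using Y card by (intro card_ge_0_finite) (simp add: card_gt_0_iff)
  moreover have "?c ` carrier Y \<subseteq> quandle_hom X Y"
    using quandle_hom_const[OF X(1) Y(1)] by auto
  ultimately show ?thesis
    by (metis card_subset_eq)
qed

text \<open>The coefficients 2 and -1 of the operation add up to 1, so affine maps commute with
  it.\<close>

lemma affine_dihedral_end:
  assumes "n > 0"
  shows "(\<lambda>x\<in>{0..<int n}. (b + d * x) mod int n) \<in> quandle_end (dihedral_quandle n)"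
proof -
  have "(b + d * ((2 * y - x) mod int n)) mod int n =
      (2 * ((b + d * y) mod int n) - (b + d * x) mod int n) mod int n" for x y
  proof -
    have "(2 * ((b + d * y) mod int n) - (b + d * x) mod int n) mod int n =
        (2 * (b + d * y) - (b + d * x)) mod int n"
      by (intro mod_diff_cong mod_mult_cong) simp_all
    moreover have "(b + d * ((2 * y - x) mod int n)) mod int n = (b + d * (2 * y - x)) mod int n"
      by (intro mod_add_cong mod_mult_cong) simp_all
    ultimately show ?thesis by (simp add: algebra_simps)
  qed
  then show ?thesis
    using assms by (auto simp: quandle_hom_def)
qed

text \<open>The argument \<open>1 mod int n\<close> instead of \<open>1\<close> covers the case \<open>n = 1\<close>.\<close>

definition slope :: "nat \<Rightarrow> (int \<Rightarrow> int) \<Rightarrow> int" where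
  "slope n \<phi> = (\<phi> (1 mod int n) - \<phi> 0) mod int n"

lemma slope_affine:
  assumes "n > 0"
  shows "slope n (\<lambda>x\<in>{0..<int n}. (b + d * x) mod int n) = d mod int n"
  using assms by (simp add: slope_def mod_simps)

text \<open>In the dihedral quandle \<open>j + 2\<close> is the product of \<open>j\<close> and
  \<open>j + 1\<close>. Hence the values of an endomorphism satisfy the recurrence
  \<open>u (j + 2) = 2 * u (j + 1) - u j\<close> modulo \<open>n\<close>, whose solutions are the
  arithmetic progressions.\<close>

lemma dihedral_end_affine:
  assumes \<phi>: "\<phi> \<in> quandle_end (dihedral_quandle n)" and x: "x \<in> {0..<int n}"
  shows "\<phi> x = (\<phi> 0 + slope n \<phi> * x) mod int n"
proof -
  have hom: "\<phi> ((2 * y - x) mod int n) = (2 * \<phi> y - \<phi> x) mod int n"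
    if "x \<in> {0..<int n}" "y \<in> {0..<int n}" for x y
    using \<phi> that by (simp add: quandle_hom_def)
  have range: "\<phi> x \<in> {0..<int n}" if "x \<in> {0..<int n}" for x
    using \<phi> that by (auto simp: quandle_hom_def)
  have "\<phi> (int k) = (\<phi> 0 + (\<phi> (1 mod int n) - \<phi> 0) * int k) mod int n" if "k < n" for k
    using that
  proof (induction k rule: less_induct)
    case (less k)
    consider "k = 0" | "k = 1" | j where "k = Suc (Suc j)"
      by (metis One_nat_def not0_implies_Suc)
    then show ?case
    proof cases
      case 1
      then show ?thesis using range[of 0] less.prems by simp
    next
      case 2
      then show ?thesis using range[of 1] less.prems by simp
    next
      case (3 j)
      let ?d = "\<phi> (1 mod int n) - \<phi> 0"
      \<comment> \<open>The reduction changes nothing, as \<open>2 * (j + 1) - j = k\<close> is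
        below \<open>n\<close>.\<close>
      have "\<phi> (int k) = \<phi> ((2 * int (Suc j) - int j) mod int n)"
        using less.prems 3 by (simp add: add.commute)
      also have "\<dots> = (2 * \<phi> (int (Suc j)) - \<phi> (int j)) mod int n"
        using less.prems 3 by (intro hom) auto
      also have "\<dots> = (2 * ((\<phi> 0 + ?d * int (Suc j)) mod int n)
          - (\<phi> 0 + ?d * int j) mod int n) mod int n"
        using less.IH[of j] less.IH[of "Suc j"] less.prems 3 by simp
      also have "\<dots> = (2 * (\<phi> 0 + ?d * int (Suc j)) - (\<phi> 0 + ?d * int j)) mod int n"
        by (intro mod_diff_cong mod_mult_cong) simp_all
      also have "2 * (\<phi> 0 + ?d * int (Suc j)) - (\<phi> 0 + ?d * int j) = \<phi> 0 + ?d * int k"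
        using 3 by (simp add: algebra_simps)
      finally show ?thesis .
    qed
  qed
  from this[of "nat x"] x have "\<phi> x = (\<phi> 0 + (\<phi> (1 mod int n) - \<phi> 0) * x) mod int n"
    by (simp add: nat_less_iff)
  also have "\<dots> = (\<phi> 0 + slope n \<phi> * x) mod int n"
    unfolding slope_def by (intro mod_add_cong mod_mult_cong) simp_all
  finally show ?thesis .
qed

text \<open>The value at \<open>x\<close> is the value at \<open>a\<close> plus the slope times
  \<open>x - a\<close>, so any point can replace 0 as base point. This makes edges with the same
  source, target and slope equal.\<close>

lemma dihedral_end_eqI:
  assumes \<phi>: "\<phi> \<in> quandle_end (dihedral_quandle n)" and \<psi>: "\<psi> \<in> quandle_end (dihedral_quandle n)"
    and a: "a \<in> {0..<int n}" "\<phi> a = \<psi> a" and slope: "slope n \<phi> = slope n \<psi>"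
  shows "\<phi> = \<psi>"
proof
  fix x
  show "\<phi> x = \<psi> x"
  proof (cases "x \<in> {0..<int n}")
    case True
    have "(\<phi> 0 + slope n \<phi> * a) mod int n = (\<psi> 0 + slope n \<phi> * a) mod int n"
      using dihedral_end_affine[OF \<phi> a(1)] dihedral_end_affine[OF \<psi> a(1)] a(2) slope by simp
    then have "(\<phi> 0 + slope n \<phi> * a + slope n \<phi> * (x - a)) mod int n =
        (\<psi> 0 + slope n \<phi> * a + slope n \<phi> * (x - a)) mod int n"
      by (rule mod_add_cong[OF _ HOL.refl])
    then show ?thesis
      using dihedral_end_affine[OF \<phi> True] dihedral_end_affine[OF \<psi> True] slope
      by (simp add: algebra_simps)
  next
    case False
    then show ?thesis
      using \<phi> \<psi> by (auto simp: quandle_hom_def PiE_def extensional_def)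
  qed
qed

lemma dihedral_coloring_quiver_complete:
  assumes n: "n > 0" and D: "link_arcs D \<noteq> {}"
    and card: "card (quandle_hom (fundamental_quandle D) (dihedral_quandle n)) = n"
  shows "digraph_iso (full_coloring_quiver (dihedral_quandle n) D) (complete_multidigraph n n)"
proof -
  let ?Q = "carrier (fundamental_quandle D)" and ?R = "dihedral_quandle n"
  let ?G = "full_coloring_quiver ?R D" and ?K = "complete_multidigraph n n"
  let ?c = "\<lambda>a. \<lambda>x\<in>?Q. a :: int"
  obtain g where "g \<in> link_arcs D" using D by blast
  then have "QGen g \<in> diagram_terms D" by simp
  then have "?Q \<noteq> {}" unfolding carrier_fundamental_quandle by blast
  \<comment> \<open>Evaluation at \<open>r\<close> recovers the value of a constant
    coloring.\<close>
  then obtain r where r: "r \<in> ?Q" by blast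
  have verts: "quandle_hom (fundamental_quandle D) ?R = ?c ` {0..<int n}"
    using quandle_hom_all_const[OF quandle_fundamental_quandle \<open>?Q \<noteq> {}\<close> quandle_dihedral[OF n]]
      n card by simp
  have end_range: "\<phi> a \<in> {0..<int n}" if "\<phi> \<in> quandle_end ?R" "a \<in> {0..<int n}" for \<phi> a
    using that by (auto simp: quandle_hom_def)
  have slope_range: "slope n \<phi> \<in> {0..<int n}" for \<phi>
    using n by (simp add: slope_def)
  have arcs: "arcs ?G = ?c ` {0..<int n} \<times> quandle_end ?R"
    by (simp add: full_coloring_quiver_def verts)
  have edgeE: thesis
    if "e \<in> arcs ?G"
      "\<And>a \<phi>. e = (?c a, \<phi>) \<Longrightarrow> a \<in> {0..<int n} \<Longrightarrow> \<phi> \<in> quandle_end ?R \<Longrightarrow> thesis"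
    for e thesis
    using that(1) unfolding arcs by (elim SigmaE imageE) (rule that(2), simp_all)
  \<comment> \<open>An edge goes to the triple of its source value, its target value and its slope;
    the slope numbers the parallel edges. Head and tail are those of \<open>?K\<close>, so that the
    image of \<open>?G\<close> under \<open>h\<close> can equal \<open>?K\<close> on the
    nose.\<close>
  define h where "h = \<lparr>iso_verts = (\<lambda>f. nat (f r)),
    iso_arcs = (\<lambda>(f, \<phi>). (nat (f r), nat (\<phi> (f r)), nat (slope n \<phi>))),
    iso_head = head ?K, iso_tail = tail ?K\<rparr>"
  have vinj: "inj_on (iso_verts h) (verts ?G)"
    using r by (auto simp: h_def full_coloring_quiver_def verts eq_nat_nat_iff intro!: inj_onI)
  have ainj: "inj_on (iso_arcs h) (arcs ?G)"
  proof (rule inj_onI)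
    fix e e' assume e: "e \<in> arcs ?G" "e' \<in> arcs ?G" "iso_arcs h e = iso_arcs h e'"
    obtain a \<phi> where a: "e = (?c a, \<phi>)" "a \<in> {0..<int n}" "\<phi> \<in> quandle_end ?R"
      using e(1) by (rule edgeE)
    obtain b \<psi> where b: "e' = (?c b, \<psi>)" "b \<in> {0..<int n}" "\<psi> \<in> quandle_end ?R"
      using e(2) by (rule edgeE)
    have eq: "nat a = nat b" "nat (\<phi> a) = nat (\<psi> b)" "nat (slope n \<phi>) = nat (slope n \<psi>)"
      using e(3) r by (simp_all add: a(1) b(1) h_def)
    have ab: "a = b" using eq(1) a(2) b(2) by (simp add: eq_nat_nat_iff)
    have "\<phi> a = \<psi> a"
      using eq(2) end_range[OF a(3,2)] end_range[OF b(3,2)] by (simp add: ab eq_nat_nat_iff)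
    moreover have "slope n \<phi> = slope n \<psi>"
      using eq(3) slope_range[of \<phi>] slope_range[of \<psi>] by (simp add: eq_nat_nat_iff)
    ultimately have "\<phi> = \<psi>" by (rule dihedral_end_eqI[OF a(3) b(3) a(2)])
    then show "e = e'" using a(1) b(1) ab by simp
  qed
  \<comment> \<open>The head of the edge \<open>(f, \<phi>)\<close> is the composite of
    \<open>\<phi>\<close> and \<open>f\<close>, whose value at \<open>r\<close> is the second entry
    of the triple.\<close>
  have incidence: "iso_verts h (tail ?G e) = iso_tail h (iso_arcs h e) \<and>
      iso_verts h (head ?G e) = iso_head h (iso_arcs h e)" for e
    using r by (cases e) (simp add: h_def full_coloring_quiver_def complete_multidigraph_def compose_eq)
  have vsurj: "iso_verts h ` verts ?G = verts ?K"
  proof -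
    have "iso_verts h ` verts ?G = nat ` {0..<int n}"
      using r by (simp add: h_def full_coloring_quiver_def verts image_image)
    also have "\<dots> = {..<n}" by (simp add: lessThan_atLeast0 image_image flip: image_int_atLeastLessThan[of 0 n, simplified])
    finally show ?thesis by (simp add: complete_multidigraph_def)
  qed
  have asurj: "iso_arcs h ` arcs ?G = arcs ?K"
  proof
    show "iso_arcs h ` arcs ?G \<subseteq> arcs ?K"
    proof (rule image_subsetI)
      fix e assume "e \<in> arcs ?G"
      then obtain a \<phi> where a: "e = (?c a, \<phi>)" "a \<in> {0..<int n}" "\<phi> \<in> quandle_end ?R"
        by (rule edgeE)
      then show "iso_arcs h e \<in> arcs ?K"
        using r end_range[OF a(3,2)] slope_range[of \<phi>]
        by (simp add: h_def complete_multidigraph_def nat_less_iff)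
    qed
    show "arcs ?K \<subseteq> iso_arcs h ` arcs ?G"
    proof
      fix e assume "e \<in> arcs ?K"
      then obtain u v k where e: "e = (u, v, k)" "u < n" "v < n" "k < n"
        by (auto simp: complete_multidigraph_def)
      \<comment> \<open>The intercept \<open>v - k * u\<close> is the one for which the map of slope
        \<open>k\<close> sends \<open>u\<close> to \<open>v\<close>.\<close>
      define \<phi> where
        "\<phi> = (\<lambda>x\<in>{0..<int n}. (int v - int k * int u + int k * x) mod int n)"
      have "\<phi> (int u) = int v" using e by (simp add: \<phi>_def)
      moreover have "slope n \<phi> = int k" using e slope_affine[OF n] by (simp add: \<phi>_def)
      ultimately have "e = iso_arcs h (?c (int u), \<phi>)" using r by (simp add: h_def e(1))
      moreover have "(?c (int u), \<phi>) \<in> arcs ?G"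
        using affine_dihedral_end[OF n] e(2) by (simp add: arcs \<phi>_def)
      ultimately show "e \<in> iso_arcs h ` arcs ?G" by (rule image_eqI)
    qed
  qed
  have "pre_digraph.digraph_isomorphism ?G h"
    using vinj ainj incidence wf_full_coloring_quiver by (simp add: pre_digraph.digraph_isomorphism_def)
  moreover have "?K = app_iso h ?G"
    unfolding app_iso_def vsurj asurj by (simp add: h_def complete_multidigraph_def)
  ultimately show ?thesis unfolding digraph_iso_def by blast
qed

lemma torus_link_arcs_nonempty:
  assumes "p > 0"
  shows "link_arcs (torus_link p q) \<noteq> {}"
proof -
  \<comment> \<open>This is the bottom point of the first strand; its class is an arc of the
    closure.\<close>
  have "(1, 0) \<in> braid_points p (torus_braid p q)"
    using assms by (simp add: braid_points_def)
  then show ?thesis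
    unfolding torus_link_def braid_closure_def by (auto dest: quotientI)
qed

theorem theorem4p1:
  fixes p q n :: nat
  assumes "prime p" and "q > 0" and "n > 0"
    and "card (quandle_hom (fundamental_quandle (torus_link p q)) (dihedral_quandle n)) = n"
  shows "digraph_iso (full_coloring_quiver (dihedral_quandle n) (torus_link p q))
           (complete_multidigraph n n)"
  by (rule dihedral_coloring_quiver_complete
      [OF \<open>n > 0\<close> torus_link_arcs_nonempty[OF prime_gt_0_nat[OF \<open>prime p\<close>]] assms(4)])

end
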